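(* Let $\mathcal{F}=\{F_i : i\in\mathbb{N}\}$ be a countable family of contractive similarities of $\mathbb{R}$, i.e. for each $i$ there is $r_i<1$ such that $|F_i(x)-F_i(y)|=r_i|x-y|$ for all $x,y\in\mathbb{R}$. If there exists a unique bounded invariant set for $\mathcal{F}$, then $r:=\sup_i r_i<1$.
   Context: A non-empty set $E\subset\mathbb{R}$ is an invariant set for $\mathcal{F}$ if $E=\overline{\bigcup_{i=1}^\infty F_i(E)}$. *)

theory Defs
  imports "HOL-Analysis.Analysis"
begin

text \<open>No lower bound on the ratio \<open>c\<close> is imposed; the equation itself forces \<open>0 \<le> c\<close>
  and determines \<open>c\<close> uniquely.\<close>

definition contractive_similarity :: "(real \<Rightarrow> real) \<Rightarrow> real \<Rightarrow> bool" where
  "contractive_similarity f c \<longleftrightarrow> c < 1 \<and> (\<forall>x y. \<bar>f x - f y\<bar> = c * \<bar>x - y\<bar>)"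

definition invariant_set :: "(nat \<Rightarrow> real \<Rightarrow> real) \<Rightarrow> real set \<Rightarrow> bool" where
  "invariant_set F E \<longleftrightarrow> E \<noteq> {} \<and> E = closure (\<Union>i. F i ` E)"

end

theory Submission
  imports Defs
begin

text \<open>The proof is by contraposition: if the ratios come arbitrarily close to 1, then a single
  bounded invariant set \<open>E\<close> already forces a whole continuum of them. Let \<open>a\<close>, \<open>b\<close> be the end
  points of the convex hull of \<open>E\<close>, which belong to \<open>E\<close> because \<open>E\<close> is closed, and \<open>m\<close>
  its midpoint. Each \<open>F i\<close> is affine and maps \<open>a\<close> and
  \<open>b\<close> into \<open>{a..b}\<close>, to points at distance \<open>r i * (b - a)\<close>; this leaves so little room that \<open>m\<close> is
  displaced by at most \<open>(1 - r i) * (b - a) / 2\<close> (\<open>midpoint_displacement\<close>).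
  Hence for every \<open>R > (b - a) / 2\<close> the interval of radius \<open>R\<close> about \<open>m\<close> is mapped into
  itself by all the \<open>F i\<close>. Its images are subintervals whose lengths come arbitrarily close to
  the full length, so their union is dense and the interval is itself invariant
  (\<open>invariant_set_cball\<close>). Two different radii contradict uniqueness.\<close>

text \<open>The distances of \<open>f x\<close> from the two values \<open>f 0\<close> and \<open>f 1\<close> determine \<open>f x\<close>, unless the
  ratio vanishes and \<open>f\<close> is constant.\<close>

lemma contractive_similarity_affine:
  assumes "contractive_similarity f c"
  obtains s where "\<bar>s\<bar> = c" and "\<And>x. f x = f 0 + s * x"
proof -
  have dist: "\<bar>f x - f y\<bar> = c * \<bar>x - y\<bar>" for x y
    using assms by (simp add: contractive_similarity_def)
  define s where "s = f 1 - f 0"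
  have s: "\<bar>s\<bar> = c"
    using dist[of 1 0] by (simp add: s_def)
  have sq: "(f x - f y)\<^sup>2 = s\<^sup>2 * (x - y)\<^sup>2" for x y
  proof -
    have "\<bar>f x - f y\<bar>\<^sup>2 = (\<bar>s\<bar> * \<bar>x - y\<bar>)\<^sup>2"
      using dist s by simp
    then show ?thesis
      by (simp add: power_mult_distrib)
  qed
  have "f x = f 0 + s * x" for x
  proof (cases "s = 0")
    case True
    then show ?thesis using sq[of x 0] by simp
  next
    case False
    have "f x - f 1 = (f x - f 0) - s"
      by (simp add: s_def)
    then have "((f x - f 0) - s)\<^sup>2 = s\<^sup>2 * (x - 1)\<^sup>2"
      using sq[of x 1] by metis
    then have "s * (f x - f 0) = s * (s * x)"
      using sq[of x 0] by (simp add: power2_eq_square algebra_simps)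
    then show ?thesis using False by simp
  qed
  with s show ?thesis using that by blast
qed

lemma midpoint_displacement:
  assumes f: "contractive_similarity f c"
    and ab: "f a \<in> {a..b}" "f b \<in> {a..b}"
  shows "\<bar>f ((a + b) / 2) - (a + b) / 2\<bar> \<le> (1 - c) * ((b - a) / 2)"
proof -
  obtain s where s: "\<And>x. f x = f 0 + s * x"
    using contractive_similarity_affine[OF f] by blast
  have mid: "f ((a + b) / 2) = (f a + f b) / 2"
    by (simp add: s[of a] s[of b] s[of "(a + b) / 2"] field_simps)
  have "a \<le> b"
    using ab by auto
  then have len: "\<bar>f a - f b\<bar> = c * (b - a)"
    using f by (simp add: contractive_similarity_def)
  have "\<bar>f a + f b - (a + b)\<bar> \<le> (b - a) - \<bar>f a - f b\<bar>"
    using ab by auto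
  then have "\<bar>f a + f b - (a + b)\<bar> \<le> (1 - c) * (b - a)"
    by (simp add: len algebra_simps)
  then show ?thesis
    by (simp add: mid abs_le_iff field_simps)
qed

text \<open>The displacement bound says exactly that the image of the interval, which has radius
  \<open>r i * R\<close> about \<open>F i m\<close>, stays inside the interval. It also contains every point within
  \<open>(2 * r i - 1) * R\<close> of \<open>m\<close>, so the images exhaust the interior as the ratios approach 1.\<close>

lemma invariant_set_cball:
  assumes F: "\<And>i. contractive_similarity (F i) (r i)"
    and disp: "\<And>i. \<bar>F i m - m\<bar> \<le> (1 - r i) * R"
    and near1: "\<And>t. t < 1 \<Longrightarrow> \<exists>i. t < r i"
    and R: "R > 0"
  shows "invariant_set F (cball m R)"
proof -
  have dist: "\<bar>F i x - F i y\<bar> = r i * \<bar>x - y\<bar>" for i x y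
    using F by (simp add: contractive_similarity_def)
  have r0: "0 \<le> r i" for i
    using dist[of i 1 0] by simp
  have "(\<Union>i. F i ` cball m R) \<subseteq> cball m R"
  proof clarify
    fix i x assume "x \<in> cball m R"
    then have "\<bar>x - m\<bar> \<le> R"
      by (simp add: dist_real_def abs_minus_commute)
    then have "\<bar>F i x - F i m\<bar> \<le> r i * R"
      using dist r0 by (simp add: mult_left_mono)
    with disp[of i] have "\<bar>F i x - m\<bar> \<le> R"
      by (simp add: algebra_simps)
    then show "F i x \<in> cball m R"
      by (simp add: dist_real_def abs_minus_commute)
  qed
  then have sub: "closure (\<Union>i. F i ` cball m R) \<subseteq> cball m R"
    by (simp add: closure_minimal)
  have "ball m R \<subseteq> (\<Union>i. F i ` cball m R)"
  proof
    fix x assume "x \<in> ball m R"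
    then have x: "\<bar>x - m\<bar> < R"
      by (simp add: dist_real_def abs_minus_commute)
    \<comment> \<open>The threshold is chosen so that \<open>(2 * r i - 1) * R\<close> exceeds the distance of \<open>x\<close> from \<open>m\<close>.\<close>
    have "(1 + \<bar>x - m\<bar> / R) / 2 < 1"
      using x R by simp
    then obtain i where i: "(1 + \<bar>x - m\<bar> / R) / 2 < r i"
      using near1 by blast
    then have "R + \<bar>x - m\<bar> < 2 * (r i * R)"
      using R by (simp add: field_simps)
    then have close: "\<bar>x - F i m\<bar> < r i * R"
      using disp[of i] by (simp add: algebra_simps)
    obtain s where s: "\<bar>s\<bar> = r i" "\<And>y. F i y = F i 0 + s * y"
      using contractive_similarity_affine[OF F] by blast
    have ri: "r i > 0"
      using close r0[of i] by (cases "r i = 0") auto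
    then have s0: "s \<noteq> 0"
      using s(1) by auto
    define y where "y = m + (x - F i m) / s"
    have "F i y = F i m + s * (y - m)"
      using s(2)[of y] s(2)[of m] by (simp add: algebra_simps)
    then have "F i y = x"
      using s0 by (simp add: y_def)
    moreover have "\<bar>y - m\<bar> \<le> R"
      using close ri by (simp add: y_def s(1) field_simps)
    then have "y \<in> cball m R"
      by (simp add: dist_real_def abs_minus_commute)
    ultimately show "x \<in> (\<Union>i. F i ` cball m R)"
      by blast
  qed
  then have "closure (ball m R) \<subseteq> closure (\<Union>i. F i ` cball m R)"
    by (rule closure_mono)
  with sub R show ?thesis
    by (auto simp: invariant_set_def)
qed

theorem corollary2p11:
  fixes F :: "nat \<Rightarrow> real \<Rightarrow> real" and r :: "nat \<Rightarrow> real"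
  assumes "\<And>i. contractive_similarity (F i) (r i)"
    and "\<exists>!E. bounded E \<and> invariant_set F E"
  shows "(SUP i. r i) < 1"
proof (rule ccontr)
  assume sup: "\<not> (SUP i. r i) < 1"
  have near1: "\<exists>i. t < r i" if "t < 1" for t
  proof (rule ccontr)
    assume "\<nexists>i. t < r i"
    then have "(SUP i. r i) \<le> t"
      by (intro cSUP_least) (auto simp: not_less)
    with sup \<open>t < 1\<close> show False by simp
  qed
  obtain E where E: "bounded E" "invariant_set F E"
    using assms(2) by blast
  have ne: "E \<noteq> {}" and eq: "E = closure (\<Union>i. F i ` E)"
    using E(2) by (auto simp: invariant_set_def)
  have "closed E"
    by (subst eq) simp
  have FE: "F i x \<in> E" if "x \<in> E" for i x
    using that closure_subset[of "\<Union>i. F i ` E"] eq by blast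
  define a b where "a = Inf E" and "b = Sup E"
  have bdd: "bdd_below E" "bdd_above E"
    using E(1) by (auto simp: bounded_imp_bdd_below bounded_imp_bdd_above)
  have ab: "a \<in> E" "b \<in> E"
    using ne bdd \<open>closed E\<close>
    by (auto simp: a_def b_def intro: closed_contains_Inf closed_contains_Sup)
  have hull: "E \<subseteq> {a..b}"
    using bdd by (auto simp: a_def b_def intro: cInf_lower cSup_upper)
  define m where "m = (a + b) / 2"
  have invariant: "invariant_set F (cball m R)" if R: "R > (b - a) / 2" for R
  proof (rule invariant_set_cball[OF assms(1) _ near1])
    fix i
    have "\<bar>F i m - m\<bar> \<le> (1 - r i) * ((b - a) / 2)"
      unfolding m_def using FE ab hull by (intro midpoint_displacement assms(1)) blast+
    also have "\<dots> \<le> (1 - r i) * R"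
      using assms(1)[of i] R by (intro mult_left_mono) (auto simp: contractive_similarity_def)
    finally show "\<bar>F i m - m\<bar> \<le> (1 - r i) * R" .
  next
    show "R > 0"
      using R ab hull by auto
  qed
  define R where "R = (b - a) / 2 + 1"
  have "cball m R = cball m (R + 1)"
    using assms(2) invariant[of R] invariant[of "R + 1"] bounded_cball
    by (auto simp: R_def)
  moreover have "a \<le> b"
    using ab hull by auto
  then have "R > 0"
    by (simp add: R_def field_simps)
  ultimately show False
    by (simp add: cball_eq_cball_iff)
qed

end
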